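(* Let $A=A_s=\mathrm{diag}(\lambda_1,\ldots,\lambda_n)=\mathrm{diag}(\mu_1I_{n_1},\ldots,\mu_\kappa I_{n_\kappa})\in\mathbb C^{n\times n}$ with pairwise different $\mu_1,\ldots,\mu_\kappa$, and assume $\dim\mathcal C^{\rm for}(A_s)<\infty$. For $1\le k\le\kappa$ let $\mathfrak r_k^*$ be the (finite) number of $m\in\mathbb Z_+^n$ with $|m|\ge 2$ and $\langle m,\lambda\rangle=\mu_k$. Then for every formal vector field $f=A_s+\cdots$ with linear part $A=A_s$ in Poincaré–Dulac normal form, $$n_1^2+\cdots+n_\kappa^2\le\dim\mathcal C^{\rm for}(f)\le n_1(n_1+\mathfrak r_1^* )+\cdots+n_\kappa(n_\kappa+\mathfrak r_\kappa^* ).$$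
   Context: Formal vector fields on $\mathbb C^n$ are elements of $\mathbb C[[x_1,\ldots,x_n]]^n$; a matrix $B$ is identified with the linear vector field $x\mapsto Bx$. The Lie bracket is $[g,h](x)=Dh(x)g(x)-Dg(x)h(x)$, and $\mathcal C^{\rm for}(f)=\{g\in\mathbb C[[x_1,\ldots,x_n]]^n;\ [g,f]=0\}$; dimensions are over $\mathbb C$. A formal vector field $f(x)=Ax+\text{(terms of degree}\ge2)$ is in Poincaré–Dulac normal form if $[A_s,f]=0$, with $A_s$ the semisimple part of $A$. $\mathbb Z_+$ denotes the nonnegative integers, $\langle m,\lambda\rangle=\sum m_i\lambda_i$, $|m|=\sum m_i$. *)

theory Defs
  imports "HOL-Analysis.Analysis" "HOL-Library.Function_Algebras"
begin

section \<open>Formal power series in the variables indexed by a finite type\<close>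

type_synonym 'n multi_index = "'n \<Rightarrow> nat"

text \<open>A series is the family of its coefficients; every family is allowed. The additive structure
  is the pointwise one from \<^theory>\<open>HOL-Library.Function_Algebras\<close>, but the pointwise product of
  that theory is \<^emph>\<open>not\<close> the product of series, which is \<open>mfps_mult\<close> below.\<close>

type_synonym 'n mfps = "'n multi_index \<Rightarrow> complex"

definition mi_degree :: "'n::finite multi_index \<Rightarrow> nat" where
  "mi_degree m = (\<Sum>i\<in>UNIV. m i)"

definition mi_pairing :: "'n::finite multi_index \<Rightarrow> ('n \<Rightarrow> complex) \<Rightarrow> complex" where
  "mi_pairing m l = (\<Sum>i\<in>UNIV. of_nat (m i) * l i)"

definition mi_unit :: "'n \<Rightarrow> 'n multi_index" where
  "mi_unit j = (\<lambda>i. if i = j then 1 else 0)"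

lemma finite_multi_index_le: "finite {p :: 'n::finite multi_index. p \<le> m}"
proof -
  have "{p. p \<le> m} = (\<Pi>\<^sub>E i\<in>UNIV. {..m i})"
    by (auto simp: le_fun_def PiE_def Pi_def)
  thus ?thesis by (simp add: finite_PiE)
qed

definition mfps_mult :: "'n::finite mfps \<Rightarrow> 'n mfps \<Rightarrow> 'n mfps" where
  "mfps_mult a b = (\<lambda>m. \<Sum>p | p \<le> m. a p * b (m - p))"

definition mfps_pderiv :: "'n \<Rightarrow> 'n mfps \<Rightarrow> 'n mfps" where
  "mfps_pderiv j a = (\<lambda>m. of_nat (m j + 1) * a (m(j := m j + 1)))"


section \<open>Formal vector fields\<close>

type_synonym 'n formal_vf = "'n mfps ^ 'n"

definition fvf_scale :: "complex \<Rightarrow> 'n formal_vf \<Rightarrow> 'n::finite formal_vf" where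
  "fvf_scale c g = (\<chi> i. (\<lambda>m. c * (g $ i) m))"

interpretation fvf: vector_space "fvf_scale :: complex \<Rightarrow> 'n formal_vf \<Rightarrow> 'n::finite formal_vf"
  by unfold_locales (auto simp: fvf_scale_def vec_eq_iff fun_eq_iff algebra_simps)

text \<open>The library's \<open>dim\<close> is natural-valued and is \<open>0\<close> on infinite-dimensional spaces, so finite
  dimensionality has to be stated separately.\<close>

definition fvf_finite_dim :: "'n::finite formal_vf set \<Rightarrow> bool" where
  "fvf_finite_dim V \<longleftrightarrow> (\<exists>B. finite B \<and> V \<subseteq> fvf.span B)"

definition fvf_bracket :: "'n::finite formal_vf \<Rightarrow> 'n formal_vf \<Rightarrow> 'n formal_vf" where
  "fvf_bracket g h = (\<chi> i. \<Sum>j\<in>UNIV.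
      mfps_mult (mfps_pderiv j (h $ i)) (g $ j) - mfps_mult (mfps_pderiv j (g $ i)) (h $ j))"

definition formal_centralizer :: "'n::finite formal_vf \<Rightarrow> 'n formal_vf set" where
  "formal_centralizer f = {g. fvf_bracket g f = 0}"

definition linear_vf :: "complex ^ 'n ^ 'n \<Rightarrow> 'n::finite formal_vf" where
  "linear_vf B = (\<chi> i. (\<lambda>m. \<Sum>j\<in>UNIV. if m = mi_unit j then B $ i $ j else 0))"

definition linear_part :: "'n::finite formal_vf \<Rightarrow> complex ^ 'n ^ 'n" where
  "linear_part f = (\<chi> i j. (f $ i) (mi_unit j))"

definition vanishes_at_0 :: "'n::finite formal_vf \<Rightarrow> bool" where
  "vanishes_at_0 f \<longleftrightarrow> (\<forall>i. (f $ i) 0 = 0)"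


section \<open>Semisimple part and Poincare--Dulac normal form\<close>

definition diag_matrix :: "('n \<Rightarrow> complex) \<Rightarrow> complex ^ 'n ^ 'n::finite" where
  "diag_matrix d = (\<chi> i j. if i = j then d i else 0)"

definition diagonalizable :: "complex ^ 'n ^ 'n::finite \<Rightarrow> bool" where
  "diagonalizable S \<longleftrightarrow> (\<exists>(P :: complex ^ 'n ^ 'n) d. invertible P \<and> S = P ** diag_matrix d ** matrix_inv P)"

definition nilpotent_matrix :: "complex ^ 'n ^ 'n::finite \<Rightarrow> bool" where
  "nilpotent_matrix N \<longleftrightarrow> (\<exists>k. (((**) N) ^^ k) (mat 1) = 0)"

text \<open>The Jordan--Chevalley decomposition \<open>A = S + N\<close>, which determines \<open>S\<close> uniquely; over the
  complex numbers semisimple means diagonalizable.\<close>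

definition is_semisimple_part :: "complex ^ 'n ^ 'n \<Rightarrow> complex ^ 'n ^ 'n::finite \<Rightarrow> bool" where
  "is_semisimple_part A S \<longleftrightarrow>
     diagonalizable S \<and> nilpotent_matrix (A - S) \<and> S ** (A - S) = (A - S) ** S"

definition poincare_dulac_nf :: "'n::finite formal_vf \<Rightarrow> bool" where
  "poincare_dulac_nf f \<longleftrightarrow> vanishes_at_0 f \<and>
     (\<exists>S. is_semisimple_part (linear_part f) S \<and> fvf_bracket (linear_vf S) f = 0)"

definition resonances :: "('n::finite \<Rightarrow> complex) \<Rightarrow> complex \<Rightarrow> 'n multi_index set" where
  "resonances l c = {m. 2 \<le> mi_degree m \<and> mi_pairing m l = c}"

end

theory Submission imports Defs begin

text \<open>For diagonal \<open>A\<close>, the centralizer of \<open>A\<close> consists of the vector fields supported on the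
  resonant monomials \<open>x\<^sup>m e\<^sub>i\<close> with \<open>\<langle>m, \<lambda>\<rangle> = \<lambda>\<^sub>i\<close>. The bracket adds the weights
  \<open>\<langle>m, \<lambda>\<rangle> - \<lambda>\<^sub>i\<close>, and the nonlinear part of \<open>f\<close> has weight zero and raises degrees. So the
  lowest-degree term of nonzero weight in a field commuting with \<open>f\<close> would have to commute with
  \<open>A\<close>, which is impossible: the centralizer of \<open>f\<close> lies in that of \<open>A\<close>, which gives the upper
  bound. Finite dimensionality excludes integrals of \<open>A\<close> and resonant constant fields, so bracketing
  with \<open>f\<close> maps the centralizer of \<open>A\<close> to its part of degree at least two; rank--nullity gives
  the lower bound.\<close>

section \<open>Rank--nullity on a finite-dimensional subspace\<close>

text \<open>Coordinates with respect to \<open>B\<close> agree with those over \<open>S\<close> and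
  with those over \<open>T\<close>, so a basis vector with nonzero coefficient would lie in both
  sets.\<close>

lemma (in vector_space) span_Int_disjoint:
  assumes "independent B" "S \<subseteq> B" "T \<subseteq> B" "S \<inter> T = {}" "x \<in> span S" "x \<in> span T"
  shows "x = 0"
proof -
  have S: "representation B x = representation S x"
    using assms by (intro representation_extend) auto
  have T: "representation B x = representation T x"
    using assms by (intro representation_extend) auto
  have "representation B x b = 0" for b
    using S T representation_ne_zero[of S x b] representation_ne_zero[of T x b] assms(4) by force
  then have "{b. representation B x b \<noteq> 0} = {}" by auto
  moreover have "x \<in> span B"
    using assms span_mono by blast
  ultimately show ?thesis
    using sum_nonzero_representation_eq[OF assms(1), of x] by simp
qed

text \<open>A basis \<open>B\<close> of the kernel is extended to a basis \<open>B'\<close> of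
  \<open>L\<close>; the images of the added vectors are independent in the span of \<open>D\<close>,
  so at most \<open>card D\<close> vectors are added.\<close>

lemma (in vector_space_pair) dim_le_dim_kernel_add_card:
  assumes lin: "Vector_Spaces.linear s1 s2 T"
    and L: "L \<subseteq> vs1.span C" "finite C" "vs1.subspace L"
    and D: "T ` L \<subseteq> vs2.span D" "finite D"
  shows "vs1.dim L \<le> vs1.dim {x \<in> L. T x = 0} + card D"
proof -
  interpret T: Vector_Spaces.linear s1 s2 T by fact
  define K where "K = {x \<in> L. T x = 0}"
  obtain B where B: "B \<subseteq> K" "vs1.independent B" "K \<subseteq> vs1.span B" "card B = vs1.dim K"
    using vs1.basis_exists by blast
  have "B \<subseteq> L" using B(1) by (auto simp: K_def)
  then obtain B' where B': "B \<subseteq> B'" "B' \<subseteq> L" "vs1.independent B'" "L \<subseteq> vs1.span B'"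
    using vs1.maximal_independent_subset_extend B(2) by metis
  have fin: "finite B'"
    using vs1.independent_span_bound[of C B'] L B' by auto
  \<comment> \<open>A kernel vector in the span of the added vectors lies in \<open>L\<close>, hence
    also in the span of \<open>B\<close>, and these two spans meet only in 0.\<close>
  have inj: "inj_on T (vs1.span (B' - B))"
  proof -
    have "x = 0" if x: "x \<in> vs1.span (B' - B)" "T x = 0" for x
    proof -
      have "vs1.span (B' - B) \<subseteq> L"
        using B'(2) L(3) by (intro vs1.span_minimal) auto
      then have "x \<in> vs1.span B"
        using x B(3) by (auto simp: K_def)
      then show "x = 0"
        using vs1.span_Int_disjoint[OF B'(3), of "B' - B" B x] B'(1) x(1) by auto
    qed
    then show ?thesis
      using T.inj_on_iff_eq_0[OF vs1.subspace_span] by blast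
  qed
  have "vs1.independent (B' - B)"
    using B'(3) vs1.independent_mono by blast
  then have "vs2.independent (T ` (B' - B))"
    using inj T.independent_injective_image by blast
  moreover have "T ` (B' - B) \<subseteq> vs2.span D"
    using B'(2) D(1) by blast
  ultimately have "card (T ` (B' - B)) \<le> card D"
    using vs2.independent_span_bound[OF D(2)] by blast
  moreover have "card (T ` (B' - B)) = card B' - card B"
    using inj inj_on_subset[OF inj vs1.span_superset] B'(1) fin
    by (simp add: card_image card_Diff_subset finite_subset)
  moreover have "card B' = vs1.dim L"
    using B' by (intro vs1.basis_card_eq_dim)
  ultimately show ?thesis
    using B(4) by (simp add: K_def)
qed

section \<open>Uniqueness of the semisimple part of a diagonal matrix\<close>

lemma diag_matrix_mult_component:
  "(diag_matrix d *v v) $ i = d i * v $ i" for v :: "complex ^ 'n::finite"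
  by (simp add: diag_matrix_def matrix_vector_mult_def if_distrib[of "\<lambda>x. x * _"] cong: if_cong)

lemma matrix_funpow_mult_vector:
  "(((**) M) ^^ k) (mat 1) *v v = (((*v) M) ^^ k) v" for M :: "complex ^ 'n::finite ^ 'n"
  by (induction k) (simp_all add: matrix_vector_mul_assoc[symmetric])

lemma matrix_inv_inverse:
  assumes "invertible P"
  shows "P ** matrix_inv P = mat 1" "matrix_inv P ** P = mat 1"
  using someI_ex[OF assms[unfolded invertible_def]] by (simp_all add: matrix_inv_def)

text \<open>Identifies the existentially quantified \<open>S\<close> in
  \<open>poincare_dulac_nf\<close>. The nilpotent part \<open>M\<close> commutes with
  \<open>S\<close>, so it preserves each eigenspace of \<open>S\<close> and acts there as a diagonal
  matrix minus a scalar; nilpotence makes this action zero. The columns of \<open>P\<close> are a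
  basis of eigenvectors, so \<open>M = 0\<close>.\<close>

lemma semisimple_part_diag_matrix:
  fixes S :: "complex ^ 'n::finite ^ 'n"
  assumes "is_semisimple_part (diag_matrix l) S"
  shows "S = diag_matrix l"
proof -
  define M where "M = diag_matrix l - S"
  obtain P :: "complex ^ 'n ^ 'n" and d where P: "invertible P" "S = P ** diag_matrix d ** matrix_inv P"
    using assms unfolding is_semisimple_part_def diagonalizable_def by blast
  obtain k where k: "(((**) M) ^^ k) (mat 1) = 0"
    using assms by (auto simp: is_semisimple_part_def nilpotent_matrix_def M_def)
  have comm: "S ** M = M ** S"
    using assms by (simp add: is_semisimple_part_def M_def)
  have SP: "S ** P = P ** diag_matrix d"
    using P matrix_inv_inverse[OF P(1)] by (simp add: matrix_mul_assoc[symmetric])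
  have eigen: "M *v v = 0" if v: "S *v v = c *s v" for v c
  proof -
    have S_pow: "S *v (((*v) M) ^^ q) v = c *s (((*v) M) ^^ q) v" for q
    proof (induction q)
      case (Suc q)
      then show ?case
        by (simp add: matrix_vector_mul_assoc comm)
           (simp add: matrix_vector_mul_assoc[symmetric] vector_scalar_commute)
    qed (use v in simp)
    have pow: "((((*v) M) ^^ q) v) $ i = (l i - c) ^ q * v $ i" for q i
    proof (induction q)
      case (Suc q)
      define w where "w = (((*v) M) ^^ q) v"
      have "M *v w = diag_matrix l *v w - c *s w"
        using S_pow[of q] by (simp add: M_def w_def matrix_vector_mult_diff_rdistrib)
      then have "(M *v w) $ i = (l i - c) * w $ i"
        by (simp add: diag_matrix_mult_component left_diff_distrib)
      then show ?case using Suc by (simp add: w_def)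
    qed simp
    have "(l i - c) ^ k * v $ i = 0" for i
      using pow[of k i] k matrix_funpow_mult_vector[of k M v] by simp
    \<comment> \<open>One of the two factors vanishes, so the exponent can be lowered to 1; for
      \<open>k = 0\<close> it is \<open>v $ i\<close> that vanishes.\<close>
    then have "(l i - c) * v $ i = 0" for i
      by (metis mult_eq_0_iff power_not_zero)
    then show "M *v v = 0"
      using pow[of 1] by (simp add: vec_eq_iff)
  qed
  have "M ** P = 0"
  proof -
    have "M *v column j P = 0" for j
    proof (rule eigen)
      have "S *v column j P = column j (S ** P)"
        by (simp add: vec_eq_iff column_def matrix_vector_mult_def matrix_matrix_mult_def)
      also have "\<dots> = d j *s column j P"
        unfolding SP
        by (simp add: vec_eq_iff column_def matrix_matrix_mult_def diag_matrix_def
            if_distrib[of "\<lambda>x. _ * x"] mult.commute cong: if_cong)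
      finally show "S *v column j P = d j *s column j P" .
    qed
    then show ?thesis
      by (simp add: vec_eq_iff column_def matrix_vector_mult_def matrix_matrix_mult_def)
  qed
  then have "M = 0"
    using matrix_inv_inverse[OF P(1)] by (metis matrix_mul_assoc matrix_mul_rid times0_left)
  then show ?thesis by (simp add: M_def)
qed

section \<open>Formal vector fields with prescribed monomials\<close>

text \<open>The pair \<open>(i, m)\<close> encodes the field \<open>x^m e_i\<close>.\<close>

definition monomial_vf :: "'n \<times> 'n multi_index \<Rightarrow> 'n::finite formal_vf" where
  "monomial_vf x = (\<chi> i. (\<lambda>m. if (i, m) = x then 1 else 0))"

text \<open>Infinite formal sums are included, so for infinite \<open>R\<close> this space is larger
  than the span of its monomials.\<close>

definition supported_vf :: "('n \<times> 'n multi_index) set \<Rightarrow> 'n::finite formal_vf set" where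
  "supported_vf R = {g. \<forall>i m. (g $ i) m \<noteq> 0 \<longrightarrow> (i, m) \<in> R}"

lemma inj_monomial_vf: "inj monomial_vf"
proof (rule injI)
  fix x y :: "'a \<times> 'a multi_index"
  assume "monomial_vf x = monomial_vf y"
  then have "(monomial_vf x $ fst x) (snd x) = (monomial_vf y $ fst x) (snd x)" by simp
  then show "x = y" by (simp add: monomial_vf_def split: if_splits)
qed

lemma sum_vf_component: "((sum h S) $ i) m = (\<Sum>x\<in>S. (h x $ i) m)"
  for h :: "'a \<Rightarrow> 'n::finite formal_vf"
  by (induction S rule: infinite_finite_induct) auto

lemma independent_monomials: "fvf.independent (monomial_vf ` R)"
  unfolding fvf.independent_explicit_finite_subsets
proof (intro allI impI ballI)
  fix S u v
  assume S: "S \<subseteq> monomial_vf ` R" "finite S" "(\<Sum>v\<in>S. fvf_scale (u v) v) = 0" "v \<in> S"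
  obtain i m where v: "v = monomial_vf (i, m)" using S by auto
  have "(w $ i) m = (if w = v then 1 else 0)" if "w \<in> S" for w
    using that S(1) v by (auto simp: monomial_vf_def)
  then have "((\<Sum>v\<in>S. fvf_scale (u v) v) $ i) m = (\<Sum>w\<in>S. if w = v then u w else 0)"
    unfolding sum_vf_component by (intro sum.cong) (auto simp: fvf_scale_def)
  then show "u v = 0" using S by simp
qed

lemma supported_vf_subspace: "fvf.subspace (supported_vf R)"
  unfolding fvf.subspace_def supported_vf_def fvf_scale_def
  by (auto; metis add.right_neutral)

lemma monomial_vf_supported: "monomial_vf ` R \<subseteq> supported_vf R"
  by (auto simp: monomial_vf_def supported_vf_def split: if_splits)

lemma supported_vf_subset_span:
  assumes "finite R"
  shows "supported_vf R \<subseteq> fvf.span (monomial_vf ` R)"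
proof
  fix g :: "'a formal_vf" assume g: "g \<in> supported_vf R"
  have "(g $ i) m = ((\<Sum>x\<in>R. fvf_scale ((g $ fst x) (snd x)) (monomial_vf x)) $ i) m" for i m
  proof -
    have "((\<Sum>x\<in>R. fvf_scale ((g $ fst x) (snd x)) (monomial_vf x)) $ i) m
        = (\<Sum>x\<in>R. if x = (i, m) then (g $ i) m else 0)"
      unfolding sum_vf_component by (intro sum.cong) (auto simp: fvf_scale_def monomial_vf_def)
    then show ?thesis
      using g assms by (auto simp: supported_vf_def)
  qed
  then have "g = (\<Sum>x\<in>R. fvf_scale ((g $ fst x) (snd x)) (monomial_vf x))"
    unfolding vec_eq_iff fun_eq_iff by blast
  then show "g \<in> fvf.span (monomial_vf ` R)"
    by (metis (no_types, lifting) fvf.span_base fvf.span_scale fvf.span_sum imageI)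
qed

lemma card_monomials: "card (monomial_vf ` R) = card R"
  by (rule card_image) (rule inj_on_subset[OF inj_monomial_vf subset_UNIV])

lemma dim_supported_vf:
  assumes "finite R"
  shows "fvf.dim (supported_vf R) = card R"
  using fvf.basis_card_eq_dim[OF monomial_vf_supported supported_vf_subset_span[OF assms]
      independent_monomials] card_monomials by metis

text \<open>Monomials are independent even for infinite \<open>R\<close>, so a finite spanning set
  bounds their number. This turns the finite-dimensionality hypothesis into finiteness of a set of
  indices.\<close>

lemma finite_dim_supported_vf_iff: "fvf_finite_dim (supported_vf R) \<longleftrightarrow> finite R"
proof
  assume "fvf_finite_dim (supported_vf R)"
  then obtain B where "finite B" "supported_vf R \<subseteq> fvf.span B"
    by (auto simp: fvf_finite_dim_def)
  then have "finite (monomial_vf ` R)"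
    using fvf.independent_span_bound[OF _ independent_monomials] monomial_vf_supported by blast
  then show "finite R"
    by (rule finite_imageD) (rule inj_on_subset[OF inj_monomial_vf subset_UNIV])
next
  assume "finite R"
  then show "fvf_finite_dim (supported_vf R)"
    using supported_vf_subset_span by (auto simp: fvf_finite_dim_def)
qed

section \<open>Degrees and weights of multi-indices\<close>

lemma multi_index_upd_eq: "m(j := m j + 1) = m + mi_unit j" for m :: "'n multi_index"
  by (auto simp: mi_unit_def)

lemma mi_degree_add: "mi_degree (p + q) = mi_degree p + mi_degree q"
  by (simp add: mi_degree_def sum.distrib)

lemma mi_pairing_add: "mi_pairing (p + q) l = mi_pairing p l + mi_pairing q l"
  by (simp add: mi_pairing_def sum.distrib algebra_simps)

lemma mi_degree_unit [simp]: "mi_degree (mi_unit j) = 1"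
  by (simp add: mi_degree_def mi_unit_def)

lemma mi_pairing_unit [simp]: "mi_pairing (mi_unit j) l = l j"
  by (simp add: mi_pairing_def mi_unit_def if_distrib[of of_nat] if_distrib[of "\<lambda>x. x * _"] cong: if_cong)

lemma mi_degree_0_iff [simp]: "mi_degree m = 0 \<longleftrightarrow> m = 0"
  by (auto simp: mi_degree_def fun_eq_iff)

lemma mi_unit_nonzero [simp]: "mi_unit j \<noteq> 0"
  by (auto simp: mi_unit_def fun_eq_iff)

lemma inj_mi_unit: "inj mi_unit"
  by (auto simp: inj_def mi_unit_def fun_eq_iff)

lemma multi_index_diff_add: "p \<le> m \<Longrightarrow> p + (m - p) = m" for m :: "'n multi_index"
  by (auto simp: le_fun_def fun_eq_iff)

lemma mi_degree_1_iff: "mi_degree m = 1 \<longleftrightarrow> (\<exists>j. m = mi_unit j)"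
proof
  assume deg: "mi_degree m = 1"
  then obtain j where j: "m j \<noteq> 0" by (fastforce simp: mi_degree_def)
  define q where "q = m - mi_unit j"
  have m: "m = mi_unit j + q"
    using j multi_index_diff_add[of "mi_unit j" m] by (auto simp: q_def mi_unit_def le_fun_def)
  with deg have "q = 0" using mi_degree_add[of "mi_unit j" q] by simp
  with m show "\<exists>j. m = mi_unit j" by auto
qed auto

text \<open>Unlike in \<open>resonances\<close>, the degree is unrestricted: linear terms with
  \<open>l i = l j\<close>, and constant terms with \<open>l i = 0\<close>, belong to the
  set.\<close>

definition resonant :: "('n::finite \<Rightarrow> complex) \<Rightarrow> ('n \<times> 'n multi_index) set" where
  "resonant l = {(i, m). mi_pairing m l = l i}"

text \<open>A nonzero \<open>q\<close> with pairing 0 gives a monomial first integral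
  \<open>x^q\<close>, whose powers would produce infinitely many resonant monomials.\<close>

lemma resonant_nonzero:
  assumes "finite (resonant l)" "(i, m) \<in> resonant l"
  shows "m \<noteq> 0"
proof
  have no_integral: "q = 0" if q: "mi_pairing q l = 0" for q
  proof (rule ccontr)
    assume "q \<noteq> 0"
    then obtain j where j: "q j \<noteq> 0" by (metis ext zero_fun_apply)
    \<comment> \<open>The fields \<open>(x^q)^k x_i e_i\<close>, all of weight zero.\<close>
    define F where "F k = (i, (\<lambda>a. k * q a) + mi_unit i)" for k :: nat
    have "inj F"
    proof (rule injI)
      fix a b assume "F a = F b"
      then have "((\<lambda>x. a * q x) + mi_unit i) j = ((\<lambda>x. b * q x) + mi_unit i) j"
        by (simp add: F_def)
      then show "a = b" using j by simp
    qed
    moreover have "mi_pairing (\<lambda>a. k * q a) l = of_nat k * mi_pairing q l" for k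
      by (simp add: mi_pairing_def sum_distrib_left mult.assoc)
    then have "range F \<subseteq> resonant l"
      using q by (auto simp: F_def resonant_def mi_pairing_add)
    ultimately show False
      using assms(1) by (meson finite_subset range_inj_infinite)
  qed
  assume "m = 0"
  \<comment> \<open>A resonant constant field \<open>e_i\<close> means \<open>l i = 0\<close>, so
    the coordinate \<open>x_i\<close> itself would be an integral.\<close>
  then have "mi_pairing (mi_unit i) l = 0"
    using assms(2) unfolding mi_pairing_unit by (simp add: resonant_def mi_pairing_def)
  then have "mi_unit i = 0" by (rule no_integral)
  then show False by simp
qed

section \<open>The bracket with a vector field in normal form\<close>

lemma fvf_bracket_component:
  "(fvf_bracket g h $ i) m = (\<Sum>j\<in>UNIV. \<Sum>p | p \<le> m.
      of_nat (p j + 1) * ((h $ i) (p + mi_unit j) * (g $ j) (m - p)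
        - (g $ i) (p + mi_unit j) * (h $ j) (m - p)))"
proof -
  have sf: "(sum F S) x = (\<Sum>j\<in>S. F j x)" for F :: "'a \<Rightarrow> 'a mfps" and S x
    by (induction S rule: infinite_finite_induct) auto
  show ?thesis
    unfolding fvf_bracket_def mfps_mult_def mfps_pderiv_def multi_index_upd_eq[symmetric]
    by (simp add: sf sum_subtractf[symmetric] algebra_simps)
qed

lemma fvf_bracket_add_left: "fvf_bracket (g + g') h = fvf_bracket g h + fvf_bracket g' h"
  by (simp add: vec_eq_iff fun_eq_iff fvf_bracket_component sum.distrib[symmetric] algebra_simps)

lemma fvf_bracket_add_right: "fvf_bracket g (h + h') = fvf_bracket g h + fvf_bracket g h'"
  by (simp add: vec_eq_iff fun_eq_iff fvf_bracket_component sum.distrib[symmetric] algebra_simps)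

lemma fvf_bracket_scale_left: "fvf_bracket (fvf_scale c g) h = fvf_scale c (fvf_bracket g h)"
  by (simp add: vec_eq_iff fun_eq_iff fvf_bracket_component fvf_scale_def sum_distrib_left algebra_simps)

lemma fvf_bracket_commute: "fvf_bracket h g = - fvf_bracket g h"
  by (simp add: vec_eq_iff fun_eq_iff fvf_bracket_component sum_negf[symmetric] algebra_simps)

lemma linear_bracket_left: "Vector_Spaces.linear fvf_scale fvf_scale (\<lambda>g. fvf_bracket g f)"
  by unfold_locales (auto simp: fvf_bracket_add_left fvf_bracket_scale_left)

section \<open>The bracket with a diagonal linear field\<close>

lemma linear_vf_diag_component:
  "(linear_vf (diag_matrix l) $ i) m = (if m = mi_unit i then l i else 0)"
proof -
  have "(linear_vf (diag_matrix l) $ i) m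
      = (\<Sum>j\<in>UNIV. if m = mi_unit j then if i = j then l i else 0 else 0)"
    by (simp add: linear_vf_def diag_matrix_def cong: if_cong)
  also have "\<dots> = (\<Sum>j\<in>UNIV. if j = i then (if m = mi_unit i then l i else 0) else 0)"
    by (intro sum.cong) auto
  finally show ?thesis by simp
qed

text \<open>Monomial fields are eigenvectors: the diagonal matrix scales component \<open>i\<close>
  by \<open>l i\<close>, while the derivation that sums \<open>l j x_j d/dx_j\<close> has eigenvalue
  \<open>mi_pairing m l\<close> on \<open>x^m\<close>.\<close>

lemma bracket_linear_vf_diag:
  "(fvf_bracket g (linear_vf (diag_matrix l)) $ i) m = (l i - mi_pairing m l) * (g $ i) m"
proof -
  let ?h = "linear_vf (diag_matrix l)"
  have "(\<Sum>p | p \<le> m. of_nat (p j + 1) * ((?h $ i) (p + mi_unit j) * (g $ j) (m - p)))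
      = (if j = i then l i * (g $ i) m else 0)" for j
  proof -
    \<comment> \<open>Comparing degrees leaves only \<open>p = 0\<close> in the convolution.\<close>
    have unit: "p + mi_unit j = mi_unit i \<longleftrightarrow> p = 0 \<and> j = i" for p
    proof
      assume eq: "p + mi_unit j = mi_unit i"
      then have "mi_degree p + 1 = 1" by (metis mi_degree_add mi_degree_unit)
      then have "p = 0" by simp
      with eq show "p = 0 \<and> j = i" by (simp add: inj_eq[OF inj_mi_unit])
    qed auto
    have "(\<Sum>p | p \<le> m. of_nat (p j + 1) * ((?h $ i) (p + mi_unit j) * (g $ j) (m - p)))
        = (\<Sum>p | p \<le> m. if p = 0 then (if j = i then l i * (g $ i) m else 0) else 0)"
      unfolding linear_vf_diag_component unit by (intro sum.cong) auto
    also have "\<dots> = (if j = i then l i * (g $ i) m else 0)"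
      using finite_multi_index_le[of m] by (auto simp: le_fun_def)
    finally show ?thesis .
  qed
  moreover have "(\<Sum>p | p \<le> m. of_nat (p j + 1) * ((g $ i) (p + mi_unit j) * (?h $ j) (m - p)))
      = of_nat (m j) * l j * (g $ i) m" for j
  \<comment> \<open>Subtraction is truncated: \<open>m - mi_unit j\<close> is the true predecessor
    only if \<open>m j\<close> is positive. Otherwise no term survives.\<close>
  proof (cases "m j = 0")
    case True
    have "m - p \<noteq> mi_unit j" for p
      using True by (auto simp: fun_eq_iff mi_unit_def intro!: exI[of _ j])
    then show ?thesis using True by (simp add: linear_vf_diag_component)
  next
    case False
    then have le: "mi_unit j \<le> m" by (auto simp: le_fun_def mi_unit_def)
    have eq: "m - p = mi_unit j \<longleftrightarrow> p = m - mi_unit j" if "p \<le> m" for p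
      using that le by (auto simp: le_fun_def fun_eq_iff) (metis diff_diff_cancel)+
    have "(\<Sum>p | p \<le> m. of_nat (p j + 1) * ((g $ i) (p + mi_unit j) * (?h $ j) (m - p)))
        = (\<Sum>p | p \<le> m. if p = m - mi_unit j then of_nat (m j) * l j * (g $ i) m else 0)"
    proof (intro sum.cong refl)
      fix p assume "p \<in> {p. p \<le> m}"
      then have p: "m - p = mi_unit j \<longleftrightarrow> p = m - mi_unit j" using eq by simp
      have "m - mi_unit j + mi_unit j = m"
        using multi_index_diff_add[OF le] by (simp add: add.commute)
      moreover have "(m - mi_unit j) j + 1 = m j" using False by (simp add: mi_unit_def)
      ultimately show "of_nat (p j + 1) * ((g $ i) (p + mi_unit j) * (?h $ j) (m - p))
          = (if p = m - mi_unit j then of_nat (m j) * l j * (g $ i) m else 0)"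
        unfolding linear_vf_diag_component p by (simp add: mult_ac del: of_nat_add of_nat_Suc)
    qed
    also have "\<dots> = of_nat (m j) * l j * (g $ i) m"
      using finite_multi_index_le[of m] by (simp add: le_fun_def)
    finally show ?thesis .
  qed
  ultimately show ?thesis
    unfolding fvf_bracket_component right_diff_distrib sum_subtractf
    by (simp add: mi_pairing_def sum_distrib_right left_diff_distrib)
qed

lemma centralizer_linear_vf_diag:
  "formal_centralizer (linear_vf (diag_matrix l)) = supported_vf (resonant l)"
  by (force simp: formal_centralizer_def supported_vf_def resonant_def vec_eq_iff fun_eq_iff
      bracket_linear_vf_diag)

section \<open>Weights, degrees and the dimension of the centralizer\<close>

text \<open>Some product in the convolution is nonzero. Its factor from \<open>h\<close> has weight
  zero and degree at least 2, and differentiation lowers the total degree by 1, so the factor from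
  \<open>g\<close> keeps the weight and has strictly smaller degree.\<close>

lemma nonzero_bracket_component:
  fixes g h :: "'n::finite formal_vf"
  assumes h: "h \<in> supported_vf (resonant l)" "\<forall>j q. mi_degree q < 2 \<longrightarrow> (h $ j) q = 0"
    and nz: "(fvf_bracket g h $ i) m \<noteq> 0"
  obtains k p where "mi_degree p < mi_degree m" "mi_pairing p l - l k = mi_pairing m l - l i"
    "(g $ k) p \<noteq> 0"
proof -
  obtain j p where p: "p \<le> m" and nzp: "(h $ i) (p + mi_unit j) * (g $ j) (m - p)
        - (g $ i) (p + mi_unit j) * (h $ j) (m - p) \<noteq> 0"
    using nz unfolding fvf_bracket_component
    by (elim sum.not_neutral_contains_not_neutral) auto
  have deg: "mi_degree m = mi_degree p + mi_degree (m - p)"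
    and pair: "mi_pairing m l = mi_pairing p l + mi_pairing (m - p) l"
    using multi_index_diff_add[OF p] mi_degree_add mi_pairing_add by metis+
  have hD: "2 \<le> mi_degree q \<and> mi_pairing q l = l a" if "(h $ a) q \<noteq> 0" for a q
    using h that by (force simp: supported_vf_def resonant_def)
  consider "(h $ i) (p + mi_unit j) \<noteq> 0" "(g $ j) (m - p) \<noteq> 0"
    | "(g $ i) (p + mi_unit j) \<noteq> 0" "(h $ j) (m - p) \<noteq> 0"
    using nzp by (metis diff_self mult_eq_0_iff)
  then show thesis
  proof cases
    case 1
    with hD[OF 1(1)] deg pair show ?thesis
      by (intro that[of "m - p" j]) (auto simp: mi_degree_add mi_pairing_add algebra_simps)
  next
    case 2
    with hD[OF 2(2)] deg pair show ?thesis
      by (intro that[of "p + mi_unit j" i]) (auto simp: mi_degree_add mi_pairing_add algebra_simps)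
  qed
qed

lemma centralizer_subset_resonant:
  assumes h: "h \<in> supported_vf (resonant l)" "\<forall>j q. mi_degree q < 2 \<longrightarrow> (h $ j) q = 0"
  shows "formal_centralizer (linear_vf (diag_matrix l) + h) \<subseteq> supported_vf (resonant l)"
proof
  fix g assume "g \<in> formal_centralizer (linear_vf (diag_matrix l) + h)"
  then have "(fvf_bracket g (linear_vf (diag_matrix l)) $ i) m + (fvf_bracket g h $ i) m = 0" for i m
    by (simp add: formal_centralizer_def fvf_bracket_add_right vec_eq_iff fun_eq_iff)
  then have eq: "(fvf_bracket g h $ i) m = (mi_pairing m l - l i) * (g $ i) m" for i m
    unfolding bracket_linear_vf_diag by (simp add: algebra_simps eq_neg_iff_add_eq_0)
  \<comment> \<open>A counterexample yields one of the same nonzero weight and smaller degree. The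
    component may change to \<open>k\<close>, hence \<open>i\<close> is arbitrary in the
    induction.\<close>
  have "mi_pairing m l \<noteq> l i \<longrightarrow> (g $ i) m = 0" for i m
  proof (induction "mi_degree m" arbitrary: i m rule: less_induct)
    case less
    show ?case
    proof (intro impI, rule ccontr)
      assume "mi_pairing m l \<noteq> l i" "(g $ i) m \<noteq> 0"
      then have "(fvf_bracket g h $ i) m \<noteq> 0" by (simp add: eq)
      then obtain k p where "mi_degree p < mi_degree m"
        "mi_pairing p l - l k = mi_pairing m l - l i" "(g $ k) p \<noteq> 0"
        by (rule nonzero_bracket_component[OF h])
      with less \<open>mi_pairing m l \<noteq> l i\<close> show False by force
    qed
  qed
  then show "g \<in> supported_vf (resonant l)"
    by (auto simp: supported_vf_def resonant_def)
qed

text \<open>The linear part contributes nothing on resonant fields. These have no constant terms by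
  \<open>resonant_nonzero\<close>, and bracketing with \<open>h\<close> raises the degree.\<close>

lemma bracket_resonant_degree_ge_2:
  assumes h: "h \<in> supported_vf (resonant l)" "\<forall>j q. mi_degree q < 2 \<longrightarrow> (h $ j) q = 0"
    and fin: "finite (resonant l)"
    and g: "g \<in> supported_vf (resonant l)"
  shows "fvf_bracket g (linear_vf (diag_matrix l) + h)
    \<in> supported_vf {(i, m) \<in> resonant l. 2 \<le> mi_degree m}"
proof -
  have "fvf_bracket g (linear_vf (diag_matrix l)) = 0"
    using g by (simp add: centralizer_linear_vf_diag[symmetric] formal_centralizer_def)
  moreover have "(i, m) \<in> resonant l \<and> 2 \<le> mi_degree m" if "(fvf_bracket g h $ i) m \<noteq> 0" for i m
    using that
  proof (rule nonzero_bracket_component[OF h])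
    fix k p assume *: "mi_degree p < mi_degree m"
        "mi_pairing p l - l k = mi_pairing m l - l i" "(g $ k) p \<noteq> 0"
    then have kp: "(k, p) \<in> resonant l" using g by (auto simp: supported_vf_def)
    then have "2 \<le> mi_degree m"
      using *(1) resonant_nonzero[OF fin kp] mi_degree_0_iff[of p] by linarith
    with * kp show ?thesis by (simp add: resonant_def)
  qed
  ultimately show ?thesis
    by (auto simp: fvf_bracket_add_right supported_vf_def)
qed

text \<open>The last claim is rank-nullity for the bracket with the full field on the resonant
  fields, written as a sum to avoid truncated subtraction.\<close>

lemma centralizer_dim_bounds:
  fixes l :: "'n::finite \<Rightarrow> complex"
  assumes h: "h \<in> supported_vf (resonant l)" "\<forall>j q. mi_degree q < 2 \<longrightarrow> (h $ j) q = 0"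
    and fin: "finite (resonant l)"
  defines "C \<equiv> formal_centralizer (linear_vf (diag_matrix l) + h)"
  shows "fvf_finite_dim C" "fvf.dim C \<le> card (resonant l)"
    "card (resonant l) \<le> fvf.dim C + card {(i, m) \<in> resonant l. 2 \<le> mi_degree m}"
proof -
  interpret P: vector_space_pair "fvf_scale :: complex \<Rightarrow> 'n formal_vf \<Rightarrow> _"
    "fvf_scale :: complex \<Rightarrow> 'n formal_vf \<Rightarrow> _" ..
  define f where "f = linear_vf (diag_matrix l) + h"
  define D where "D = {(i, m) \<in> resonant l. 2 \<le> mi_degree m}"
  have finD: "finite D" using fin by (rule rev_finite_subset) (auto simp: D_def)
  have span: "C \<subseteq> fvf.span (monomial_vf ` resonant l)"
    using centralizer_subset_resonant[OF h] supported_vf_subset_span[OF fin] by (auto simp: C_def)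
  with fin show "fvf_finite_dim C" by (auto simp: fvf_finite_dim_def)
  show "fvf.dim C \<le> card (resonant l)"
    using fvf.dim_le_card[OF span] fin by (simp add: card_monomials)
  have "(\<lambda>g. fvf_bracket g f) ` supported_vf (resonant l) \<subseteq> fvf.span (monomial_vf ` D)"
    using bracket_resonant_degree_ge_2[OF h fin] supported_vf_subset_span[OF finD]
    by (auto simp: f_def D_def)
  then have "fvf.dim (supported_vf (resonant l))
      \<le> fvf.dim {g \<in> supported_vf (resonant l). fvf_bracket g f = 0} + card (monomial_vf ` D)"
    using fin finD by (intro P.dim_le_dim_kernel_add_card[OF linear_bracket_left
          supported_vf_subset_span[OF fin] _ supported_vf_subspace]) auto
  \<comment> \<open>Restricting to resonant fields loses no part of the kernel, since the whole
    centralizer lies among them.\<close>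
  moreover have "{g \<in> supported_vf (resonant l). fvf_bracket g f = 0} = C"
    using centralizer_subset_resonant[OF h] by (auto simp: C_def f_def formal_centralizer_def)
  ultimately show "card (resonant l) \<le> fvf.dim C + card {(i, m) \<in> resonant l. 2 \<le> mi_degree m}"
    unfolding D_def dim_supported_vf[OF fin] card_monomials by metis
qed

text \<open>The semisimple part is the diagonal matrix itself, so \<open>f\<close> commutes with it
  and is resonant; subtracting the linear part leaves only terms of degree at least 2.\<close>

lemma poincare_dulac_nf_decomposition:
  assumes "linear_part f = diag_matrix l" "poincare_dulac_nf f"
  obtains h where "f = linear_vf (diag_matrix l) + h" "h \<in> supported_vf (resonant l)"
    "\<forall>j q. mi_degree q < 2 \<longrightarrow> (h $ j) q = 0"
proof
  define h where "h = f - linear_vf (diag_matrix l)"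
  show f: "f = linear_vf (diag_matrix l) + h" by (simp add: h_def)
  have "fvf_bracket (linear_vf (diag_matrix l)) f = 0"
    using assms semisimple_part_diag_matrix by (auto simp: poincare_dulac_nf_def)
  then have "fvf_bracket f (linear_vf (diag_matrix l)) = 0"
    using fvf_bracket_commute[of "linear_vf (diag_matrix l)" f] by simp
  then have "f \<in> supported_vf (resonant l)"
    by (simp add: centralizer_linear_vf_diag[symmetric] formal_centralizer_def)
  moreover have "linear_vf (diag_matrix l) \<in> supported_vf (resonant l)"
    by (auto simp: supported_vf_def linear_vf_diag_component resonant_def)
  ultimately show "h \<in> supported_vf (resonant l)"
    unfolding h_def by (rule fvf.subspace_diff[OF supported_vf_subspace])
  show "\<forall>j q. mi_degree q < 2 \<longrightarrow> (h $ j) q = 0"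
  proof (intro allI impI)
    fix j q assume "mi_degree (q :: 'a multi_index) < 2"
    then consider "mi_degree q = 0" | "mi_degree q = 1" by linarith
    then show "(h $ j) q = 0"
    proof cases
      case 1
      then have "q = 0" by simp
      then have q: "q \<noteq> mi_unit j" by (metis mi_unit_nonzero)
      from \<open>q = 0\<close> have "(f $ j) q = 0"
        using assms(2) by (simp add: poincare_dulac_nf_def vanishes_at_0_def)
      with q show ?thesis
        by (simp add: h_def linear_vf_diag_component)
    next
      case 2
      then obtain i where q: "q = mi_unit i" using mi_degree_1_iff by blast
      have "linear_part f $ j $ i = diag_matrix l $ j $ i"
        by (simp add: assms(1))
      then have "(f $ j) q = (if i = j then l j else 0)"
        by (simp add: q linear_part_def diag_matrix_def eq_commute)
      moreover have "q = mi_unit j \<longleftrightarrow> i = j"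
        by (simp add: q inj_eq[OF inj_mi_unit])
      ultimately show ?thesis
        by (simp add: h_def linear_vf_diag_component)
    qed
  qed
qed

section \<open>Counting resonances\<close>

lemma finite_resonances:
  assumes "finite (resonant l)"
  shows "finite (resonances l (l i))"
proof -
  have "(\<lambda>m. (i, m)) ` resonances l (l i) \<subseteq> resonant l"
    by (auto simp: resonances_def resonant_def)
  then show ?thesis
    using assms by (meson finite_imageD finite_subset inj_onI prod.inject)
qed

text \<open>Resonant pairs are grouped by the eigenvalue \<open>c = l i\<close>. For each such
  \<open>i\<close>, the index \<open>m\<close> is either a unit with the same eigenvalue or a
  resonance of degree at least 2; degree 0 is excluded by finiteness.\<close>

lemma
  fixes l :: "'n::finite \<Rightarrow> complex"
  assumes fin: "finite (resonant l)"
  shows card_resonant: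
      "card (resonant l) = (\<Sum>c\<in>range l. card {i. l i = c} * (card {i. l i = c} + card (resonances l c)))"
    and card_resonant_degree_ge_2:
      "card {(i, m) \<in> resonant l. 2 \<le> mi_degree m}
        = (\<Sum>c\<in>range l. card {i. l i = c} * card (resonances l c))"
proof -
  have fin_res: "finite (resonances l c)" if "c \<in> range l" for c
    using that finite_resonances[OF fin] by auto
  have "resonant l = (\<Union>c\<in>range l. {i. l i = c} \<times> (mi_unit ` {i. l i = c} \<union> resonances l c))"
  proof -
    have "m \<in> mi_unit ` {a. l a = l i} \<union> resonances l (l i)" if im: "(i, m) \<in> resonant l" for i m
    proof (cases "mi_degree m = 1")
      case True
      then obtain j where "m = mi_unit j" using mi_degree_1_iff by blast
      then show ?thesis using im by (simp add: resonant_def)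
    next
      case False
      then have "2 \<le> mi_degree m"
        using resonant_nonzero[OF fin im] mi_degree_0_iff[of m] by linarith
      then show ?thesis using im by (auto simp: resonances_def resonant_def)
    qed
    then have "resonant l \<subseteq> (\<Union>c\<in>range l. {i. l i = c} \<times> (mi_unit ` {i. l i = c} \<union> resonances l c))"
      by fastforce
    moreover have "(\<Union>c\<in>range l. {i. l i = c} \<times> (mi_unit ` {i. l i = c} \<union> resonances l c)) \<subseteq> resonant l"
      by (auto simp: resonances_def resonant_def)
    ultimately show ?thesis by (rule equalityI)
  qed
  also have "card \<dots> = (\<Sum>c\<in>range l. card ({i. l i = c} \<times> (mi_unit ` {i. l i = c} \<union> resonances l c)))"
    using fin_res by (intro card_UN_disjoint) auto
  also have "\<dots> = (\<Sum>c\<in>range l. card {i. l i = c} * (card {i. l i = c} + card (resonances l c)))"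
  proof (intro sum.cong refl)
    fix c assume c: "c \<in> range l"
    have "card (mi_unit ` {i. l i = c} \<union> resonances l c)
        = card (mi_unit ` {i. l i = c}) + card (resonances l c)"
      using fin_res[OF c] by (intro card_Un_disjoint) (auto simp: resonances_def)
    then show "card ({i. l i = c} \<times> (mi_unit ` {i. l i = c} \<union> resonances l c))
        = card {i. l i = c} * (card {i. l i = c} + card (resonances l c))"
      by (simp add: card_cartesian_product card_image inj_on_subset[OF inj_mi_unit])
  qed
  finally show "card (resonant l)
    = (\<Sum>c\<in>range l. card {i. l i = c} * (card {i. l i = c} + card (resonances l c)))" .
  have "{(i, m) \<in> resonant l. 2 \<le> mi_degree m} = (\<Union>c\<in>range l. {i. l i = c} \<times> resonances l c)"
    by (auto simp: resonances_def resonant_def)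
  also have "card \<dots> = (\<Sum>c\<in>range l. card ({i. l i = c} \<times> resonances l c))"
    using fin_res by (intro card_UN_disjoint) auto
  finally show "card {(i, m) \<in> resonant l. 2 \<le> mi_degree m}
      = (\<Sum>c\<in>range l. card {i. l i = c} * card (resonances l c))"
    by (simp add: card_cartesian_product)
qed

theorem theorem3:
  fixes A :: "complex ^ 'n ^ 'n::finite"
    and l :: "'n \<Rightarrow> complex"
    and \<kappa> :: nat
    and \<mu> :: "nat \<Rightarrow> complex"
    and N r :: "nat \<Rightarrow> nat"
    and f :: "'n formal_vf"
  assumes "A = diag_matrix l"
    and "range l = \<mu> ` {1..\<kappa>}"
    and "inj_on \<mu> {1..\<kappa>}"
    and "\<And>k. k \<in> {1..\<kappa>} \<Longrightarrow> N k = card {i. l i = \<mu> k}"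
    and "fvf_finite_dim (formal_centralizer (linear_vf A))"
    and "\<And>k. k \<in> {1..\<kappa>} \<Longrightarrow> r k = card (resonances l (\<mu> k))"
    and "linear_part f = A"
    and "poincare_dulac_nf f"
  shows "(\<forall>k\<in>{1..\<kappa>}. finite (resonances l (\<mu> k))) \<and>
    fvf_finite_dim (formal_centralizer f) \<and>
    (\<Sum>k=1..\<kappa>. (N k)\<^sup>2) \<le> fvf.dim (formal_centralizer f) \<and>
    fvf.dim (formal_centralizer f) \<le> (\<Sum>k=1..\<kappa>. N k * (N k + r k))"
proof -
  have fin: "finite (resonant l)"
    using assms(1,5) by (simp add: centralizer_linear_vf_diag finite_dim_supported_vf_iff)
  obtain h where f: "f = linear_vf (diag_matrix l) + h" and h: "h \<in> supported_vf (resonant l)"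
    "\<forall>j q. mi_degree q < 2 \<longrightarrow> (h $ j) q = 0"
    using poincare_dulac_nf_decomposition assms(1,7,8) by metis
  \<comment> \<open>Injectivity of \<open>\<mu>\<close> turns the sum over distinct eigenvalues into
    one over \<open>k\<close>.\<close>
  have sum_range: "(\<Sum>c\<in>range l. F c) = (\<Sum>k=1..\<kappa>. F (\<mu> k))" for F :: "complex \<Rightarrow> nat"
    using assms(2,3) by (simp add: sum.reindex)
  have R: "card (resonant l) = (\<Sum>k=1..\<kappa>. N k * (N k + r k))"
    unfolding card_resonant[OF fin] sum_range using assms(4,6) by (intro sum.cong) auto
  have R2: "card {(i, m) \<in> resonant l. 2 \<le> mi_degree m} = (\<Sum>k=1..\<kappa>. N k * r k)"
    unfolding card_resonant_degree_ge_2[OF fin] sum_range using assms(4,6) by (intro sum.cong) auto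
  \<comment> \<open>Cancelling the products \<open>N k * r k\<close>, counted by \<open>R2\<close>,
    leaves the squares as the lower bound.\<close>
  have "card (resonant l) = (\<Sum>k=1..\<kappa>. (N k)\<^sup>2) + (\<Sum>k=1..\<kappa>. N k * r k)"
    by (simp add: R sum.distrib power2_eq_square distrib_left)
  moreover have "finite (resonances l (\<mu> k))" if "k \<in> {1..\<kappa>}" for k
  proof -
    have "\<mu> k \<in> range l" using that assms(2) by blast
    then show ?thesis using finite_resonances[OF fin] by auto
  qed
  ultimately show ?thesis
    using centralizer_dim_bounds[OF h fin] R R2 by (auto simp: f)
qed

end
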